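(* Let $\epsilon,\epsilon'\in(0,0.5)$ be constants, $\ell\in\mathbb{N}$ and $k\le\ell-4$. Suppose $\mathtt{nmE}:[2^\ell-1]\times[2^\ell-1]\to\{0,1\}$ is a non-malleable two-source $(k,\epsilon)$-extractor such that for every $x$, $|\{y:\mathtt{nmE}(x,y)=1\}|>\epsilon'\cdot2^\ell$, and suppose $B:[2^\ell-1]\times[2^{\ell+2}-1]\to\{0,1\}$ is quasi-orthogonal with error $0.1\epsilon'$. Let $G=(V_0\cup V_1\cup V_2,E)$ be the $(6\cdot2^\ell-3)$-vertex graph with $V_\sigma=\{\langle\sigma,i\rangle:i\in[2^{\ell_\sigma}-1]\}$, $\ell_0=\ell_1=\ell$, $\ell_2=\ell+2$, and $E=\{\{\langle1,i\rangle,\langle0,j\rangle\}:\mathtt{nmE}(i,j)=1\}\cup\{\{\langle\sigma,i\rangle,\langle2,j\rangle\}:B(i,j)=1,\sigma\in\{0,1\}\}\cup\binom{V_1}{2}\cup\binom{V_2}{2}$. Let $V=V_0\cup V_1\cup V_2$. Then $G$ is $\Omega(|V|)$-robustly self-ordered (with the constant depending only on $\epsilon,\epsilon'$). Furthermore, every vertex of $G$ has degree at least $0.3|V|$ and at most $0.9|V|$.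
   Context: Here the sources are over $[N]$ with $N=2^\ell-1$: a random variable over $[N]$ is a $k$-source if each value has probability at most $2^{-k}$. $\mathtt{nmE}:[N]\times[N]\to\{0,1\}$ is a non-malleable two-source $(k,\epsilon)$-extractor if for every two independent such sources $X,Y$ and every $f,g:[N]\to[N]$ without fixed points, $\frac12\sum_{\alpha,\beta\in\{0,1\}}\big|\Pr[(\mathtt{nmE}(X,Y),\mathtt{nmE}(f(X),g(Y)))=(\alpha,\beta)]-\frac12\Pr[\mathtt{nmE}(f(X),g(Y))=\beta]\big|\le\epsilon$. A bipartite adjacency predicate $B:X\times Y\to\{0,1\}$ is quasi-orthogonal with error $\delta$ if (1) for every $x\in X$, $|\{y:B(x,y)=1\}|=(0.5\pm\delta)|Y|$, and for every $y\in Y$, $|\{x:B(x,y)=1\}|=(0.5\pm\delta)|X|$; and (2) for every $x\ne x'\in X$, $|\{y:B(x,y)\ne B(x',y)\}|=(0.5\pm\delta)|Y|$, and similarly for every $y\ne y'\in Y$. A graph $G=(V,E)$ is $\rho$-robustly self-ordered if for every permutation $\pi$ of $V$, $|E\triangle\{\{\pi(u),\pi(v)\}:\{u,v\}\in E\}|\ge\rho|\{v:\pi(v)\ne v\}|$. *)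

theory Defs
  imports "HOL-Probability.Probability" "HOL-Combinatorics.Permutations" "HOL-Library.Ramsey"
begin

text \<open>Throughout, $[n]$ is the set \<open>{1..n}\<close> of naturals and $\{0,1\}$ is \<open>bool\<close>, with 1 being \<open>True\<close>.\<close>

definition is_source :: "nat \<Rightarrow> real \<Rightarrow> nat pmf \<Rightarrow> bool" where
  "is_source N k X \<longleftrightarrow> set_pmf X \<subseteq> {1..N} \<and> (\<forall>x\<in>{1..N}. pmf X x \<le> 2 powr (- k))"

definition fixpoint_free_on :: "nat \<Rightarrow> (nat \<Rightarrow> nat) \<Rightarrow> bool" where
  "fixpoint_free_on N f \<longleftrightarrow> f \<in> {1..N} \<rightarrow> {1..N} \<and> (\<forall>x\<in>{1..N}. f x \<noteq> x)"

text \<open>Independence of the two sources: their joint law is the product \<open>pair_pmf X Y\<close>.\<close>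

definition nm_two_source_extractor ::
    "nat \<Rightarrow> real \<Rightarrow> real \<Rightarrow> (nat \<Rightarrow> nat \<Rightarrow> bool) \<Rightarrow> bool" where
  "nm_two_source_extractor N k \<epsilon> nmE \<longleftrightarrow>
     (\<forall>X Y f g. is_source N k X \<and> is_source N k Y \<and> fixpoint_free_on N f \<and> fixpoint_free_on N g \<longrightarrow>
        1/2 * (\<Sum>\<alpha>\<in>(UNIV :: bool set). \<Sum>\<beta>\<in>(UNIV :: bool set).
          \<bar>measure_pmf.prob (pair_pmf X Y) {(x, y). (nmE x y, nmE (f x) (g y)) = (\<alpha>, \<beta>)}
           - 1/2 * measure_pmf.prob (pair_pmf X Y) {(x, y). nmE (f x) (g y) = \<beta>}\<bar>) \<le> \<epsilon>)"

definition quasi_orthogonal :: "'a set \<Rightarrow> 'b set \<Rightarrow> ('a \<Rightarrow> 'b \<Rightarrow> bool) \<Rightarrow> real \<Rightarrow> bool" where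
  "quasi_orthogonal X Y B \<delta> \<longleftrightarrow>
     (\<forall>x\<in>X. \<bar>real (card {y\<in>Y. B x y}) - 0.5 * real (card Y)\<bar> \<le> \<delta> * real (card Y)) \<and>
     (\<forall>y\<in>Y. \<bar>real (card {x\<in>X. B x y}) - 0.5 * real (card X)\<bar> \<le> \<delta> * real (card X)) \<and>
     (\<forall>x\<in>X. \<forall>x'\<in>X. x \<noteq> x' \<longrightarrow>
        \<bar>real (card {y\<in>Y. B x y \<noteq> B x' y}) - 0.5 * real (card Y)\<bar> \<le> \<delta> * real (card Y)) \<and>
     (\<forall>y\<in>Y. \<forall>y'\<in>Y. y \<noteq> y' \<longrightarrow>
        \<bar>real (card {x\<in>X. B x y \<noteq> B x y'}) - 0.5 * real (card X)\<bar> \<le> \<delta> * real (card X))"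

text \<open>A graph is given by its vertex set and its set of edges, which are two-element vertex sets.\<close>

definition robustly_self_ordered :: "real \<Rightarrow> 'v set \<Rightarrow> 'v set set \<Rightarrow> bool" where
  "robustly_self_ordered \<rho> V E \<longleftrightarrow>
     (\<forall>\<pi>. \<pi> permutes V \<longrightarrow>
        real (card (sym_diff E ((\<lambda>e. \<pi> ` e) ` E))) \<ge> \<rho> * real (card {v\<in>V. \<pi> v \<noteq> v}))"

definition degree_in :: "'v set set \<Rightarrow> 'v \<Rightarrow> nat" where
  "degree_in E v = card {e\<in>E. v \<in> e}"

definition part_exp :: "nat \<Rightarrow> nat \<Rightarrow> nat" where
  "part_exp l \<sigma> = (if \<sigma> = 2 then l + 2 else l)"

definition G_part :: "nat \<Rightarrow> nat \<Rightarrow> (nat \<times> nat) set" where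
  "G_part l \<sigma> = {(\<sigma>, i) | i. i \<in> {1..2 ^ part_exp l \<sigma> - 1}}"

definition G_verts :: "nat \<Rightarrow> (nat \<times> nat) set" where
  "G_verts l = G_part l 0 \<union> G_part l 1 \<union> G_part l 2"

text \<open>\<open>[A]\<^bsup>2\<^esup>\<close> is the library's notation for the set of two-element subsets of \<open>A\<close>.\<close>

definition G_edges ::
    "nat \<Rightarrow> (nat \<Rightarrow> nat \<Rightarrow> bool) \<Rightarrow> (nat \<Rightarrow> nat \<Rightarrow> bool) \<Rightarrow> (nat \<times> nat) set set" where
  "G_edges l nmE B =
     {{(1, i), (0, j)} | i j. i \<in> {1..2 ^ l - 1} \<and> j \<in> {1..2 ^ l - 1} \<and> nmE i j} \<union>
     {{(\<sigma>, i), (2, j)} | \<sigma> i j.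
        \<sigma> \<in> {0, 1} \<and> i \<in> {1..2 ^ l - 1} \<and> j \<in> {1..2 ^ (l + 2) - 1} \<and> B i j} \<union>
     [G_part l 1]\<^bsup>2\<^esup> \<union> [G_part l 2]\<^bsup>2\<^esup>"

lemma G_part_eq: "G_part l \<sigma> = Pair \<sigma> ` {1..2 ^ part_exp l \<sigma> - 1}"
  by (auto simp: G_part_def)

lemma card_G_part: "card (G_part l \<sigma>) = 2 ^ part_exp l \<sigma> - 1"
  unfolding G_part_eq by (subst card_image) (auto simp: inj_on_def)

lemma finite_G_verts: "finite (G_verts l)"
  by (simp add: G_verts_def G_part_eq)

lemma card_G_verts: "card (G_verts l) = 6 * 2 ^ l - 3"
proof -
  have "card (G_verts l) = card (G_part l 0) + card (G_part l 1) + card (G_part l 2)"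
    unfolding G_verts_def
    by (subst card_Un_disjoint; (subst card_Un_disjoint)?) (auto simp: G_part_eq)
  moreover have "(2::nat) ^ l \<ge> 1"
    by simp
  ultimately show ?thesis
    unfolding card_G_part part_exp_def by (simp add: power_add)
qed

lemma G_edges_subset: "G_edges l nmE B \<subseteq> [G_verts l]\<^bsup>2\<^esup>"
  unfolding G_edges_def G_verts_def
  by (auto simp: nsets_def G_part_eq part_exp_def)

end

theory Submission
  imports Defs
begin

text \<open>Count, for each vertex $v$, the vertices $u$ for which adjacency of $u, v$ differs from that of
  $\pi(u), \pi(v)$; the sum over $v$ is at most twice $|E \triangle \pi(E)|$. A vertex leaving its part
  contributes $\Omega(|V|)$ because vertices in different parts have degrees differing by
  $\Omega(|V|)$. A vertex moved inside $V_2$ contributes $\Omega(|V|)$ by quasi-orthogonality, unless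
  $\pi$ moves many vertices in each of $V_0$ and $V_1$; likewise for a vertex moved inside $V_0$ or
  $V_1$, unless $\pi$ moves many vertices of $V_2$. If $\pi$ moves many vertices in both $V_0$ and
  $V_1$, then either many of them leave their part, or non-malleability, applied to the uniform
  distributions on the vertices moved inside $V_1$ and $V_0$ and to $\pi$ as the tampering functions,
  gives $\Omega(|V|^2)$ disagreeing pairs between $V_1$ and $V_0$. In the remaining cases either every
  moved vertex contributes $\Omega(|V|)$, or there are $\Omega(|V|)$ such vertices.\<close>

section \<open>Edges changed by a permutation of an arbitrary finite graph\<close>

definition disagreement :: "'v set \<Rightarrow> 'v set set \<Rightarrow> ('v \<Rightarrow> 'v) \<Rightarrow> 'v \<Rightarrow> nat" where
  "disagreement V E \<pi> v = card {u\<in>V. ({u, v} \<in> E) \<noteq> ({\<pi> u, \<pi> v} \<in> E)}"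

text \<open>A disagreeing ordered pair \<open>(v, u)\<close> is sent to
  \<open>{\<pi> u, \<pi> v}\<close>, which lies in exactly one of \<open>E\<close> and its image
  under \<pi>. As \<pi> is injective, each edge is reached from at most two ordered pairs, hence the
  factor 2.\<close>

lemma sum_disagreement_le:
  fixes V :: "'v set"
  assumes V: "finite V" and E: "E \<subseteq> [V]\<^bsup>2\<^esup>" and \<pi>: "\<pi> permutes V"
  shows "(\<Sum>v\<in>V. disagreement V E \<pi> v) \<le> 2 * card (sym_diff E ((`) \<pi> ` E))"
proof -
  define S where "S = (SIGMA v:V. {u\<in>V. ({u, v} \<in> E) \<noteq> ({\<pi> u, \<pi> v} \<in> E)})"
  define D where "D = sym_diff E ((`) \<pi> ` E)"
  define P where "P e = {p \<in> V \<times> V. {\<pi> (fst p), \<pi> (snd p)} = e}" for e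
  have inj: "inj \<pi>" and im: "\<pi> ` V = V"
    using \<pi> by (auto simp: permutes_inj permutes_image)
  have D_sub: "D \<subseteq> [V]\<^bsup>2\<^esup>"
  proof -
    have "\<pi> ` e \<in> [V]\<^bsup>2\<^esup>" if "e \<in> E" for e
      using that E im inj by (auto simp: nsets_def card_image inj_on_subset)
    then show ?thesis
      using E by (auto simp: D_def)
  qed
  have fin_D: "finite D"
    using D_sub finite_imp_finite_nsets[OF V] finite_subset by blast
  have "S \<subseteq> (\<Union>e\<in>D. P e)"
  proof
    fix p assume "p \<in> S"
    then obtain v u where p: "p = (v, u)" "v \<in> V" "u \<in> V"
      and ne: "({u, v} \<in> E) \<noteq> ({\<pi> u, \<pi> v} \<in> E)"
      by (auto simp: S_def)
    have "{\<pi> u, \<pi> v} \<in> (`) \<pi> ` E \<longleftrightarrow> {u, v} \<in> E"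
      using inj_image_eq_iff[OF inj, of "{u, v}"] by (auto simp: image_iff)
    then have "{\<pi> v, \<pi> u} \<in> D"
      using ne by (auto simp: D_def insert_commute)
    then show "p \<in> (\<Union>e\<in>D. P e)"
      using p by (auto simp: P_def)
  qed
  moreover have "card (P e) \<le> 2" if "e \<in> D" for e
  proof -
    have "e \<in> [V]\<^bsup>2\<^esup>"
      using that D_sub by blast
    then obtain a b where e: "e = {a, b}" "a \<in> V" "b \<in> V"
      by (rule nsets2_E)
    obtain a' b' where "a = \<pi> a'" "b = \<pi> b'"
      using e im by (metis imageE)
    then have "P e \<subseteq> {(a', b'), (b', a')}"
      using inj e by (auto simp: P_def doubleton_eq_iff inj_eq)
    then have "card (P e) \<le> card {(a', b'), (b', a')}"
      by (intro card_mono) auto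
    also have "\<dots> \<le> 2"
      by (cases "a' = b'") auto
    finally show ?thesis .
  qed
  ultimately have S: "S \<subseteq> (\<Union>e\<in>D. P e)" and P2: "\<And>e. e \<in> D \<Longrightarrow> card (P e) \<le> 2"
    by blast+
  have "finite (\<Union>e\<in>D. P e)"
    using V fin_D by (simp add: P_def)
  then have "card S \<le> card (\<Union>e\<in>D. P e)"
    by (rule card_mono) (fact S)
  also have "\<dots> \<le> (\<Sum>e\<in>D. card (P e))"
    by (rule card_UN_le[OF fin_D])
  also have "(\<Sum>e\<in>D. card (P e)) \<le> (\<Sum>e\<in>D. 2)"
    by (rule sum_mono) (fact P2)
  finally have "card S \<le> 2 * card D"
    by simp
  moreover have "card S = (\<Sum>v\<in>V. disagreement V E \<pi> v)"
    unfolding S_def disagreement_def using V by simp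
  ultimately show ?thesis
    by (simp add: D_def)
qed

lemma degree_in_eq_card_neighbours:
  assumes V: "finite V" and E: "E \<subseteq> [V]\<^bsup>2\<^esup>"
  shows "degree_in E v = card {u\<in>V. {u, v} \<in> E}"
proof -
  have "bij_betw (\<lambda>u. {u, v}) {u\<in>V. {u, v} \<in> E} {e\<in>E. v \<in> e}"
    unfolding bij_betw_def
  proof
    show "inj_on (\<lambda>u. {u, v}) {u\<in>V. {u, v} \<in> E}"
      by (auto simp: inj_on_def doubleton_eq_iff)
    show "(\<lambda>u. {u, v}) ` {u\<in>V. {u, v} \<in> E} = {e\<in>E. v \<in> e}" (is "?L = ?R")
    proof
      show "?R \<subseteq> ?L"
      proof
        fix e assume e: "e \<in> ?R"
        then have "e \<in> [V]\<^bsup>2\<^esup>"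
          using E by blast
        then obtain a b where "e = {a, b}" "a \<in> V" "b \<in> V"
          by (rule nsets2_E)
        with e show "e \<in> ?L"
          by (auto simp: insert_commute)
      qed
    qed auto
  qed
  then show ?thesis
    by (simp add: degree_in_def bij_betw_same_card)
qed

lemma abs_card_diff_le:
  assumes "finite A" "finite B"
  shows "\<bar>real (card A) - real (card B)\<bar> \<le> real (card (sym_diff A B))"
proof -
  have "card A \<le> card (B \<union> sym_diff A B)" "card B \<le> card (A \<union> sym_diff A B)"
    using assms by (auto intro!: card_mono)
  then show ?thesis
    using card_Un_le[of B "sym_diff A B"] card_Un_le[of A "sym_diff A B"] by linarith
qed

text \<open>Pulling the neighbourhood of \<open>\<pi> v\<close> back along \<pi> keeps its size, and
  the symmetric difference between it and the neighbourhood of \<open>v\<close> is exactly the set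
  counted by \<open>disagreement\<close>.\<close>

lemma degree_diff_le_disagreement:
  assumes V: "finite V" and E: "E \<subseteq> [V]\<^bsup>2\<^esup>" and \<pi>: "\<pi> permutes V"
  shows "\<bar>real (degree_in E v) - real (degree_in E (\<pi> v))\<bar> \<le> real (disagreement V E \<pi> v)"
proof -
  let ?A = "{u\<in>V. {u, v} \<in> E}" and ?B = "{u\<in>V. {\<pi> u, \<pi> v} \<in> E}"
  have "\<pi> ` ?B = {u\<in>V. {u, \<pi> v} \<in> E}"
  proof (intro equalityI subsetI)
    fix u assume u: "u \<in> {u\<in>V. {u, \<pi> v} \<in> E}"
    then have "u \<in> \<pi> ` V"
      using permutes_image[OF \<pi>] by simp
    then obtain u' where "u = \<pi> u'" "u' \<in> V"
      by blast
    with u show "u \<in> \<pi> ` ?B"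
      by blast
  next
    fix u assume "u \<in> \<pi> ` ?B"
    then show "u \<in> {u\<in>V. {u, \<pi> v} \<in> E}"
      using permutes_in_image[OF \<pi>] by blast
  qed
  moreover have "card (\<pi> ` ?B) = card ?B"
    by (rule card_image[OF permutes_inj_on[OF \<pi>]])
  ultimately have "card ?B = degree_in E (\<pi> v)"
    by (simp add: degree_in_eq_card_neighbours[OF V E])
  moreover have "sym_diff ?A ?B = {u\<in>V. ({u, v} \<in> E) \<noteq> ({\<pi> u, \<pi> v} \<in> E)}"
    by auto
  ultimately show ?thesis
    using abs_card_diff_le[of ?A ?B] V
    by (simp add: disagreement_def degree_in_eq_card_neighbours[OF V E])
qed

text \<open>If \<pi> fixes \<open>u\<close>, and \<open>u\<close> is adjacent to just one of
  \<open>v\<close> and \<open>\<pi> v\<close>, then the pair \<open>u\<close>, \<open>v\<close>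
  disagrees. Only moved vertices of \<open>W\<close> can escape this.\<close>

lemma card_distinguishing_le_disagreement:
  assumes V: "finite V" and W: "W \<subseteq> V"
  shows "card {u\<in>W. ({u, v} \<in> E) \<noteq> ({u, \<pi> v} \<in> E)}
           \<le> disagreement V E \<pi> v + card {u\<in>W. \<pi> u \<noteq> u}"
proof -
  let ?D = "{u\<in>V. ({u, v} \<in> E) \<noteq> ({\<pi> u, \<pi> v} \<in> E)}" and ?M = "{u\<in>W. \<pi> u \<noteq> u}"
  have "card {u\<in>W. ({u, v} \<in> E) \<noteq> ({u, \<pi> v} \<in> E)} \<le> card (?D \<union> ?M)"
    using W finite_subset[OF W V] V by (intro card_mono) auto
  also have "\<dots> \<le> card ?D + card ?M"
    by (rule card_Un_le)
  finally show ?thesis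
    by (simp add: disagreement_def)
qed

section \<open>Flat sources and the non-malleable extractor\<close>

lemma pair_pmf_of_set:
  assumes "finite A" "A \<noteq> {}" "finite B" "B \<noteq> {}"
  shows "pair_pmf (pmf_of_set A) (pmf_of_set B) = pmf_of_set (A \<times> B)"
proof (rule pmf_eqI)
  fix p
  show "pmf (pair_pmf (pmf_of_set A) (pmf_of_set B)) p = pmf (pmf_of_set (A \<times> B)) p"
    using assms
    by (cases p) (simp add: pmf_pair pmf_of_set indicator_def card_cartesian_product)
qed

lemma is_source_pmf_of_set:
  assumes "A \<subseteq> {1..N}" and "2 powr k \<le> real (card A)"
  shows "is_source N k (pmf_of_set A)"
proof -
  have "A \<noteq> {}"
    using assms(2) by (auto simp: not_le)
  have "finite A"
    using assms(1) finite_subset by blast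
  have "1 / real (card A) \<le> 2 powr - k"
    using assms(2) by (simp add: powr_minus_divide frac_le)
  then show ?thesis
    using assms(1) \<open>A \<noteq> {}\<close> \<open>finite A\<close>
    by (auto simp: is_source_def pmf_of_set indicator_def)
qed

text \<open>Tampering functions must be defined on all of \<open>{1..N}\<close>, whereas a
  permutation of the graph supplies them only on the vertices moved inside a part. Elsewhere the
  constant 1 serves, except at 1 itself, which goes to 2.\<close>

lemma fixpoint_free_on_extension:
  assumes "f \<in> A \<rightarrow> {1..N}" "\<And>x. x \<in> A \<Longrightarrow> f x \<noteq> x" "2 \<le> N"
  shows "fixpoint_free_on N (\<lambda>x. if x \<in> A then f x else if x = 1 then 2 else 1)"
  using assms by (auto simp: fixpoint_free_on_def Pi_iff)

text \<open>Non-malleability makes the untampered bit nearly uniform given the tampered one, so the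
  two differ with probability at least \<open>1/2 - \<epsilon>\<close>. For uniform sources on
  \<open>A\<close> and \<open>B\<close> this probability is a proportion of
  \<open>A \<times> B\<close>.\<close>

lemma nm_two_source_extractor_changes:
  assumes nm: "nm_two_source_extractor N k \<epsilon> nmE"
    and A: "A \<subseteq> {1..N}" "2 powr k \<le> real (card A)"
    and B: "B \<subseteq> {1..N}" "2 powr k \<le> real (card B)"
    and f: "f \<in> A \<rightarrow> {1..N}" "\<And>x. x \<in> A \<Longrightarrow> f x \<noteq> x"
    and g: "g \<in> B \<rightarrow> {1..N}" "\<And>y. y \<in> B \<Longrightarrow> g y \<noteq> y"
    and N: "2 \<le> N"
  shows "(1/2 - \<epsilon>) * real (card A) * real (card B)
           \<le> real (card {(x, y) \<in> A \<times> B. nmE x y \<noteq> nmE (f x) (g y)})"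
proof -
  have fin: "finite A" "finite B"
    using A(1) B(1) finite_subset by blast+
  have "0 < real (card A)" "0 < real (card B)"
    using A(2) B(2) by (smt (verit) powr_gt_zero)+
  then have ne: "A \<noteq> {}" "B \<noteq> {}"
    by auto
  define f' where "f' x = (if x \<in> A then f x else if x = 1 then 2 else 1)" for x
  define g' where "g' y = (if y \<in> B then g y else if y = 1 then 2 else 1)" for y
  define P where "P = measure_pmf.prob (pair_pmf (pmf_of_set A) (pmf_of_set B))"
  have P: "P S = real (card ((A \<times> B) \<inter> S)) / (real (card A) * real (card B))" for S
    using fin ne by (simp add: P_def pair_pmf_of_set measure_pmf_of_set card_cartesian_product)
  define Q where "Q \<alpha> \<beta> = P {(x, y). nmE x y = \<alpha> \<and> nmE (f' x) (g' y) = \<beta>}" for \<alpha> \<beta>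
  define R where "R \<beta> = P {(x, y). nmE (f' x) (g' y) = \<beta>}" for \<beta>
  have R: "R \<beta> = Q True \<beta> + Q False \<beta>" for \<beta>
    unfolding R_def Q_def P_def
    by (subst measure_pmf.finite_measure_Union[symmetric]) (auto intro!: arg_cong2[where f = measure])
  have total: "R True + R False = 1"
    unfolding R_def P_def
    by (subst measure_pmf.finite_measure_Union[symmetric])
       (auto simp: measure_pmf.prob_eq_1 intro!: AE_pmfI)
  have "is_source N k (pmf_of_set A)" "is_source N k (pmf_of_set B)"
    by (fact is_source_pmf_of_set[OF A] is_source_pmf_of_set[OF B])+
  moreover have "fixpoint_free_on N f'" "fixpoint_free_on N g'"
    unfolding f'_def g'_def using f g N by (auto intro!: fixpoint_free_on_extension)
  ultimately have
    "1/2 * (\<Sum>\<alpha>\<in>UNIV. \<Sum>\<beta>\<in>UNIV. \<bar>Q \<alpha> \<beta> - 1/2 * R \<beta>\<bar>) \<le> \<epsilon>"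
    using nm unfolding nm_two_source_extractor_def Q_def R_def P_def by simp
  \<comment> \<open>By \<open>R\<close>, the left side equals half the sum over \<beta> of
    \<open>\<bar>Q True \<beta> - Q False \<beta>\<bar>\<close>. Hence the probability that the bits
    agree exceeds that of disagreement by at most \<open>2 * \<epsilon>\<close>, while the two add
    up to 1.\<close>
  then have "1/2 - \<epsilon> \<le> Q True False + Q False True"
    using R[of True] R[of False] total by (simp add: UNIV_bool)
  also have "\<dots> = P {(x, y). nmE x y \<noteq> nmE (f' x) (g' y)}"
    unfolding Q_def P_def
    by (subst measure_pmf.finite_measure_Union[symmetric]) (auto intro!: arg_cong2[where f = measure])
  finally have "1/2 - \<epsilon> \<le> P {(x, y). nmE x y \<noteq> nmE (f' x) (g' y)}" .
  moreover have "(A \<times> B) \<inter> {(x, y). nmE x y \<noteq> nmE (f' x) (g' y)}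
               = {(x, y) \<in> A \<times> B. nmE x y \<noteq> nmE (f x) (g y)}"
    by (auto simp: f'_def g'_def)
  ultimately have "1/2 - \<epsilon> \<le>
      real (card {(x, y) \<in> A \<times> B. nmE x y \<noteq> nmE (f x) (g y)}) / (real (card A) * real (card B))"
    by (simp add: P)
  with \<open>0 < real (card A)\<close> \<open>0 < real (card B)\<close> show ?thesis
    by (simp add: field_simps)
qed


lemma card_filter_Pair: "card {u \<in> Pair a ` S. P u} = card {i\<in>S. P (a, i)}"
proof -
  have "{u \<in> Pair a ` S. P u} = Pair a ` {i\<in>S. P (a, i)}"
    by auto
  then show ?thesis
    by (simp add: card_image inj_on_def)
qed

section \<open>The graph and its adjacency relation\<close>

locale nm_graph =
  fixes \<epsilon> \<epsilon>' k :: real and l N M :: nat and nmE B :: "nat \<Rightarrow> nat \<Rightarrow> bool"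
  assumes eps: "0 < \<epsilon>" "\<epsilon> < 1/2" and eps': "0 < \<epsilon>'" "\<epsilon>' < 1/2"
    and k: "0 \<le> k" "k \<le> real l - 4"
    and N_eq: "N = 2 ^ l - 1" and M_eq: "M = 2 ^ (l + 2) - 1"
    and extractor: "nm_two_source_extractor N k \<epsilon> nmE"
    and outdegree: "\<And>x. x \<in> {1..N} \<Longrightarrow> real (card {y\<in>{1..N}. nmE x y}) > \<epsilon>' * 2 ^ l"
    and quasi_orth: "quasi_orthogonal {1..N} {1..M} B (0.1 * \<epsilon>')"
begin

abbreviation "V \<equiv> G_verts l"
abbreviation "E \<equiv> G_edges l nmE B"

lemma two_power_l: "2 ^ l = real N + 1"
  by (simp add: N_eq of_nat_diff)

lemma M_eq_N: "M = 4 * N + 3"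
proof -
  have "(1::nat) \<le> 2 ^ l"
    by simp
  then have "4 * 2 ^ l - 1 = 4 * (2 ^ l - 1) + (3::nat)"
    by linarith
  then show ?thesis
    by (simp add: M_eq N_eq power_add mult.commute)
qed

lemma real_M: "real M = 4 * real N + 3"
  by (simp add: M_eq_N)

lemma N_ge: "15 \<le> N"
proof -
  \<comment> \<open>From \<open>0 \<le> k\<close> and \<open>k \<le> real l - 4\<close>.\<close>
  have "4 \<le> l"
    using k by linarith
  then have "(2::nat) ^ 4 \<le> 2 ^ l"
    by (intro power_increasing) auto
  then show ?thesis
    by (simp add: N_eq)
qed

lemma parts: "G_part l 0 = Pair 0 ` {1..N}" "G_part l 1 = Pair 1 ` {1..N}"
    "G_part l (Suc 0) = Pair 1 ` {1..N}" "G_part l 2 = Pair 2 ` {1..M}"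
  by (simp_all add: G_part_eq part_exp_def N_eq M_eq)

lemma finite_part: "finite (G_part l \<sigma>)"
  by (simp add: G_part_eq)

lemma card_V: "real (card V) = 6 * real N + 3"
proof -
  have "(3::nat) \<le> 6 * 2 ^ l"
    using one_le_power[of "2::nat" l] by linarith
  then have "real (card V) = 6 * 2 ^ l - 3"
    unfolding card_G_verts by (simp add: of_nat_diff)
  then show ?thesis
    using two_power_l by simp
qed

lemma V_cases:
  assumes "v \<in> V"
  obtains (V0) j where "v = (0, j)" "j \<in> {1..N}" | (V1) i where "v = (1, i)" "i \<in> {1..N}"
    | (V2) j where "v = (2, j)" "j \<in> {1..M}"
  using assms unfolding G_verts_def parts by blast

lemma singleton_not_edge: "{v} \<notin> E"
  using G_edges_subset[of l nmE B] by (auto simp: nsets_def)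

text \<open>With bounded quantifiers in place of set comprehensions, adjacency between any two given
  parts reduces to comparing doubletons.\<close>

lemma doubleton_edge_iff:
  "{u, v} \<in> E \<longleftrightarrow>
     (\<exists>i\<in>{1..N}. \<exists>j\<in>{1..N}. nmE i j \<and> {u, v} = {(1, i), (0, j)}) \<or>
     (\<exists>\<sigma>\<in>{0, 1}. \<exists>i\<in>{1..N}. \<exists>j\<in>{1..M}. B i j \<and> {u, v} = {(\<sigma>, i), (2, j)}) \<or>
     u \<in> Pair 1 ` {1..N} \<and> v \<in> Pair 1 ` {1..N} \<and> u \<noteq> v \<or>
     u \<in> Pair 2 ` {1..M} \<and> v \<in> Pair 2 ` {1..M} \<and> u \<noteq> v"
proof -
  have comprehension2: "e \<in> {f i j | i j. i \<in> I \<and> j \<in> J \<and> P i j} \<longleftrightarrow>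
      (\<exists>i\<in>I. \<exists>j\<in>J. P i j \<and> e = f i j)"
    for e :: "(nat \<times> nat) set" and f and I J :: "nat set" and P
    by blast
  have comprehension3: "e \<in> {f s i j | s i j. s \<in> S \<and> i \<in> I \<and> j \<in> J \<and> P i j} \<longleftrightarrow>
      (\<exists>s\<in>S. \<exists>i\<in>I. \<exists>j\<in>J. P i j \<and> e = f s i j)"
    for e :: "(nat \<times> nat) set" and f and S I J :: "nat set" and P
    by blast
  show ?thesis
    unfolding G_edges_def parts N_eq[symmetric] M_eq[symmetric] Un_iff doubleton_in_nsets_2
      comprehension2 comprehension3 disj_assoc
    by (rule refl)
qed

lemma edge_iff:
  "i \<in> {1..N} \<Longrightarrow> j \<in> {1..N} \<Longrightarrow> {(1, i), (0, j)} \<in> E \<longleftrightarrow> nmE i j"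
  "i \<in> {1..N} \<Longrightarrow> j \<in> {1..N} \<Longrightarrow> {(0, j), (1, i)} \<in> E \<longleftrightarrow> nmE i j"
  "\<sigma> \<in> {0, 1} \<Longrightarrow> i \<in> {1..N} \<Longrightarrow> j \<in> {1..M} \<Longrightarrow> {(\<sigma>, i), (2, j)} \<in> E \<longleftrightarrow> B i j"
  "\<sigma> \<in> {0, 1} \<Longrightarrow> i \<in> {1..N} \<Longrightarrow> j \<in> {1..M} \<Longrightarrow> {(2, j), (\<sigma>, i)} \<in> E \<longleftrightarrow> B i j"
  "{(0, i), (0, j)} \<notin> E"
  "i \<in> {1..N} \<Longrightarrow> j \<in> {1..N} \<Longrightarrow> {(1, i), (1, j)} \<in> E \<longleftrightarrow> i \<noteq> j"
  "i \<in> {1..M} \<Longrightarrow> j \<in> {1..M} \<Longrightarrow> {(2, i), (2, j)} \<in> E \<longleftrightarrow> i \<noteq> j"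
  by (auto simp: doubleton_edge_iff doubleton_eq_iff)

section \<open>Counts obtained from quasi-orthogonality\<close>

text \<open>This is \<open>M / 2\<close> with error \<open>\<epsilon>' / 10 * M\<close>, expanded by
  \<open>M = 4 * N + 3\<close> so that the product \<open>\<epsilon>' * N\<close> can be treated as
  a single unknown by linear arithmetic.\<close>

lemma B_row:
  assumes "i \<in> {1..N}"
  shows "\<bar>real (card {j\<in>{1..M}. B i j}) - (2 * real N + 3/2)\<bar> \<le> 2/5 * (\<epsilon>' * real N) + 3/10 * \<epsilon>'"
proof -
  have "\<bar>real (card {j\<in>{1..M}. B i j}) - 0.5 * real (card {1..M})\<bar> \<le> 0.1 * \<epsilon>' * real (card {1..M})"
    using quasi_orth assms unfolding quasi_orthogonal_def by blast
  then show ?thesis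
    by (simp add: real_M field_simps)
qed

lemma B_column:
  assumes "j \<in> {1..M}"
  shows "\<bar>real (card {i\<in>{1..N}. B i j}) - real N / 2\<bar> \<le> \<epsilon>' / 10 * real N"
proof -
  have "\<bar>real (card {i\<in>{1..N}. B i j}) - 0.5 * real (card {1..N})\<bar> \<le> 0.1 * \<epsilon>' * real (card {1..N})"
    using quasi_orth assms unfolding quasi_orthogonal_def by blast
  then show ?thesis
    by simp
qed

lemma B_rows:
  assumes "i \<in> {1..N}" "i' \<in> {1..N}" "i \<noteq> i'"
  shows "real M / 2 - \<epsilon>' / 10 * real M \<le> real (card {j\<in>{1..M}. B i j \<noteq> B i' j})"
    (is "_ \<le> real ?c")
proof -
  have "\<bar>real ?c - 0.5 * real (card {1..M})\<bar> \<le> 0.1 * \<epsilon>' * real (card {1..M})"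
    using quasi_orth assms unfolding quasi_orthogonal_def by blast
  then show ?thesis
    unfolding card_atLeastAtMost diff_Suc_1 by argo
qed

lemma B_columns:
  assumes "j \<in> {1..M}" "j' \<in> {1..M}" "j \<noteq> j'"
  shows "real N / 2 - \<epsilon>' / 10 * real N \<le> real (card {i\<in>{1..N}. B i j \<noteq> B i j'})"
    (is "_ \<le> real ?c")
proof -
  have "\<bar>real ?c - 0.5 * real (card {1..N})\<bar> \<le> 0.1 * \<epsilon>' * real (card {1..N})"
    using quasi_orth assms unfolding quasi_orthogonal_def by blast
  then show ?thesis
    unfolding card_atLeastAtMost diff_Suc_1 by argo
qed

text \<open>As \<open>N\<close> is odd, no subset of \<open>{1..N}\<close> has exactly half of its elements, so \<open>B\<close> can only be
  quasi-orthogonal if the error is at least \<open>1/2\<close> in absolute terms. This makes the degree gap between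
  the parts positive even for small \<open>l\<close>.\<close>
lemma eps'_N_ge: "5 \<le> \<epsilon>' * real N"
proof -
  have "odd N"
    using N_ge unfolding N_eq by (cases l) auto
  define c where "c = card {i\<in>{1..N}. B i 1}"
  have "\<bar>real c - real N / 2\<bar> \<le> \<epsilon>' / 10 * real N"
    unfolding c_def by (rule B_column) (simp add: M_eq_N)
  moreover have "2 * c \<noteq> N"
    using \<open>odd N\<close> by auto
  then have "2 * c + 1 \<le> N \<or> N + 1 \<le> 2 * c"
    by linarith
  then have "1/2 \<le> \<bar>real c - real N / 2\<bar>"
    by linarith
  ultimately show ?thesis
    by simp
qed

lemma eps'_N_le: "\<epsilon>' * real N \<le> real N / 2"
  using mult_right_mono[of \<epsilon>' "1/2" "real N"] eps' by simp

section \<open>Degrees and the gaps between the parts\<close>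

lemma degree_split:
  "degree_in E v = card {i\<in>{1..N}. {(0, i), v} \<in> E} + card {i\<in>{1..N}. {(1, i), v} \<in> E}
     + card {j\<in>{1..M}. {(2, j), v} \<in> E}"
proof -
  define W where "W \<sigma> = {u\<in>G_part l \<sigma>. {u, v} \<in> E}" for \<sigma>
  have fin: "finite (W \<sigma>)" for \<sigma>
    by (simp add: W_def finite_part)
  have disj: "W 0 \<inter> W 1 = {}" "(W 0 \<union> W 1) \<inter> W 2 = {}"
    by (auto simp: W_def G_part_def)
  have "{u\<in>V. {u, v} \<in> E} = W 0 \<union> W 1 \<union> W 2"
    by (auto simp: W_def G_verts_def)
  then have "degree_in E v = card (W 0 \<union> W 1 \<union> W 2)"
    by (simp add: degree_in_eq_card_neighbours[OF finite_G_verts G_edges_subset])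
  also have "\<dots> = card (W 0) + card (W 1) + card (W 2)"
    using disj by (simp add: card_Un_disjoint fin del: One_nat_def)
  finally show ?thesis
    unfolding W_def parts card_filter_Pair .
qed

text \<open>There are no edges inside $V_0$; $V_2$ contributes about \<open>2 * N\<close> neighbours
  and $V_1$ anything from 0 to \<open>N\<close>.\<close>

lemma degree_V0:
  assumes "j \<in> {1..N}"
  shows "2 * real N + 3/2 - 2/5 * (\<epsilon>' * real N) - 3/10 * \<epsilon>' \<le> real (degree_in E (0, j))"
    and "real (degree_in E (0, j)) \<le> 3 * real N + 3/2 + 2/5 * (\<epsilon>' * real N) + 3/10 * \<epsilon>'"
proof -
  have 0: "{i\<in>{1..N}. {(0, i), (0, j)} \<in> E} = {}"
    and 2: "{i\<in>{1..M}. {(2, i), (0, j)} \<in> E} = {i\<in>{1..M}. B j i}"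
    using assms by (auto simp: edge_iff simp del: One_nat_def)
  have "card {i\<in>{1..N}. {(1, i), (0, j)} \<in> E} \<le> card {1..N}"
    by (intro card_mono) auto
  then have "card {i\<in>{1..M}. B j i} \<le> degree_in E (0, j)"
    "degree_in E (0, j) \<le> N + card {i\<in>{1..M}. B j i}"
    unfolding degree_split 0 2 by simp_all
  then show "2 * real N + 3/2 - 2/5 * (\<epsilon>' * real N) - 3/10 * \<epsilon>' \<le> real (degree_in E (0, j))"
    "real (degree_in E (0, j)) \<le> 3 * real N + 3/2 + 2/5 * (\<epsilon>' * real N) + 3/10 * \<epsilon>'"
    using B_row[OF assms] by linarith+
qed

text \<open>The clique contributes \<open>N - 1\<close> and $V_2$ about \<open>2 * N\<close>. The
  more than \<open>\<epsilon>' * 2 ^ l\<close> neighbours in $V_0$ lift the lower bound above the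
  upper bound for $V_0$.\<close>

lemma degree_V1:
  assumes "i \<in> {1..N}"
  shows "3 * real N + 1/2 + 3/5 * (\<epsilon>' * real N) + 7/10 * \<epsilon>' < real (degree_in E (1, i))"
    and "real (degree_in E (1, i)) \<le> 4 * real N + 1/2 + 2/5 * (\<epsilon>' * real N) + 3/10 * \<epsilon>'"
proof -
  have 0: "{j\<in>{1..N}. {(0, j), (1, i)} \<in> E} = {j\<in>{1..N}. nmE i j}"
    and 1: "{j\<in>{1..N}. {(1, j), (1, i)} \<in> E} = {1..N} - {i}"
    and 2: "{j\<in>{1..M}. {(2, j), (1, i)} \<in> E} = {j\<in>{1..M}. B i j}"
    using assms by (auto simp: edge_iff singleton_not_edge simp del: One_nat_def)
  have "card {j\<in>{1..N}. nmE i j} \<le> card {1..N}"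
    by (rule card_mono) auto
  then have "card {j\<in>{1..N}. nmE i j} \<le> N"
    by simp
  moreover have "real (degree_in E (1, i))
      = real (card {j\<in>{1..N}. nmE i j}) + real N - 1 + real (card {j\<in>{1..M}. B i j})"
    unfolding degree_split 0 1 2 using assms by simp
  ultimately show "3 * real N + 1/2 + 3/5 * (\<epsilon>' * real N) + 7/10 * \<epsilon>' < real (degree_in E (1, i))"
    "real (degree_in E (1, i)) \<le> 4 * real N + 1/2 + 2/5 * (\<epsilon>' * real N) + 3/10 * \<epsilon>'"
    using B_row[OF assms] outdegree[OF assms] unfolding two_power_l distrib_left mult_1_right by linarith+
qed

text \<open>The clique contributes \<open>M - 1 = 4 * N + 2\<close>. Both $V_0$ and $V_1$ are joined
  to $V_2$ by the same \<open>B\<close>, so a column of \<open>B\<close> and its deviation count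
  twice.\<close>

lemma degree_V2:
  assumes "j \<in> {1..M}"
  shows "5 * real N + 2 - 1/5 * (\<epsilon>' * real N) \<le> real (degree_in E (2, j))"
    and "real (degree_in E (2, j)) \<le> 5 * real N + 2 + 1/5 * (\<epsilon>' * real N)"
proof -
  have 0: "{i\<in>{1..N}. {(0, i), (2, j)} \<in> E} = {i\<in>{1..N}. B i j}"
    and 1: "{i\<in>{1..N}. {(1, i), (2, j)} \<in> E} = {i\<in>{1..N}. B i j}"
    and 2: "{i\<in>{1..M}. {(2, i), (2, j)} \<in> E} = {1..M} - {j}"
    using assms by (auto simp: edge_iff singleton_not_edge simp del: One_nat_def)
  have "real (degree_in E (2, j)) = 2 * real (card {i\<in>{1..N}. B i j}) + 4 * real N + 2"
    unfolding degree_split 0 1 2 using assms by (simp add: real_M)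
  then show "5 * real N + 2 - 1/5 * (\<epsilon>' * real N) \<le> real (degree_in E (2, j))"
    "real (degree_in E (2, j)) \<le> 5 * real N + 2 + 1/5 * (\<epsilon>' * real N)"
    using B_column[OF assms] by linarith+
qed

lemma degree_bounds:
  assumes "v \<in> V"
  shows "0.3 * real (card V) \<le> real (degree_in E v)" and "real (degree_in E v) \<le> 0.9 * real (card V)"
proof -
  define p where "p = \<epsilon>' * real N"
  have N: "real N \<ge> 15"
    using N_ge by simp
  note facts = N eps' eps'_N_le[folded p_def] eps'_N_ge[folded p_def]
  \<comment> \<open>This is \<open>0.3 * (6 * N + 3)\<close>. The leading term is attained for
    $V_0$: as \<epsilon>' is below 1/2, \<open>2 * N\<close> loses at most
    \<open>N / 5\<close>.\<close>
  have "9/5 * real N + 9/10 \<le> real (degree_in E v)"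
    using assms
  proof (cases rule: V_cases)
    case (V0 j)
    show ?thesis
      using degree_V0(1)[OF V0(2), folded p_def] facts unfolding V0(1) by linarith
  next
    case (V1 i)
    show ?thesis
      using degree_V1(1)[OF V1(2), folded p_def] facts unfolding V1(1) by linarith
  next
    case (V2 j)
    show ?thesis
      using degree_V2(1)[OF V2(2), folded p_def] facts unfolding V2(1) by linarith
  qed
  then show "0.3 * real (card V) \<le> real (degree_in E v)"
    by (simp add: card_V)
  have "real (degree_in E v) \<le> 27/5 * real N + 27/10"
    using assms
  proof (cases rule: V_cases)
    case (V0 j)
    show ?thesis
      using degree_V0(2)[OF V0(2), folded p_def] facts unfolding V0(1) by linarith
  next
    case (V1 i)
    show ?thesis
      using degree_V1(2)[OF V1(2), folded p_def] facts unfolding V1(1) by linarith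
  next
    case (V2 j)
    show ?thesis
      using degree_V2(2)[OF V2(2), folded p_def] facts unfolding V2(1) by linarith
  qed
  then show "real (degree_in E v) \<le> 0.9 * real (card V)"
    by (simp add: card_V)
qed

text \<open>Degrees lie roughly in \<open>[2 * N, 3 * N]\<close>, \<open>[3 * N, 4 * N]\<close> and
  around \<open>5 * N\<close>. Only the gap between $V_0$ and $V_1$ is delicate, and it determines
  the order \<open>\<epsilon>' * N\<close> of the bound.\<close>

lemma degree_gap:
  assumes "v \<in> V" "w \<in> V" "fst v \<noteq> fst w"
  shows "1/10 * (\<epsilon>' * real N) \<le> \<bar>real (degree_in E v) - real (degree_in E w)\<bar>"
proof -
  define p where "p = \<epsilon>' * real N"
  have N: "real N \<ge> 15"
    using N_ge by simp
  note facts = N eps' eps'_N_le[folded p_def] eps'_N_ge[folded p_def]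
  have gap01: "1/10 * p \<le> real (degree_in E (1, i)) - real (degree_in E (0, j))"
    if "i \<in> {1..N}" "j \<in> {1..N}" for i j
  proof -
    have "1/5 * p + 2/5 * \<epsilon>' - 1 < real (degree_in E (1, i)) - real (degree_in E (0, j))"
      using degree_V1(1)[OF that(1), folded p_def] degree_V0(2)[OF that(2), folded p_def] facts by linarith
    moreover from this have "0 < real (degree_in E (1, i)) - real (degree_in E (0, j))"
      using facts by linarith
    \<comment> \<open>Degrees are integers, so a positive difference is at least 1. Adding this to
      the bound above cancels its \<open>- 1\<close> and gives \<open>p / 5\<close> for twice the
      difference.\<close>
    then have "degree_in E (0, j) + 1 \<le> degree_in E (1, i)"
      by simp
    then have "1 \<le> real (degree_in E (1, i)) - real (degree_in E (0, j))"
      by linarith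
    ultimately show ?thesis
      using eps' by linarith
  qed
  have gap02: "1/10 * p \<le> real (degree_in E (2, i)) - real (degree_in E (0, j))"
    if "i \<in> {1..M}" "j \<in> {1..N}" for i j
    using degree_V2(1)[OF that(1), folded p_def] degree_V0(2)[OF that(2), folded p_def] facts by linarith
  have gap12: "1/10 * p \<le> real (degree_in E (2, i)) - real (degree_in E (1, j))"
    if "i \<in> {1..M}" "j \<in> {1..N}" for i j
    using degree_V2(1)[OF that(1), folded p_def] degree_V1(2)[OF that(2), folded p_def] facts by linarith
  have gap: "1/10 * p \<le> real (degree_in E w) - real (degree_in E v)"
    if "v \<in> V" "w \<in> V" "fst v < fst w" for v w
    using that(1)
  proof (cases rule: V_cases)
    case v: (V0 j)
    from that(2) show ?thesis
    proof (cases rule: V_cases)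
      case (V1 i)
      then show ?thesis using gap01 v by blast
    next
      case (V2 i)
      then show ?thesis using gap02 v by blast
    qed (use that(3) v in simp)
  next
    case v: (V1 j)
    from that(2) show ?thesis
    proof (cases rule: V_cases)
      case (V2 i)
      then show ?thesis using gap12 v by blast
    qed (use that(3) v in simp_all)
  next
    case v: (V2 j)
    from that(2) show ?thesis
      by (cases rule: V_cases) (use that(3) v in simp_all)
  qed
  show ?thesis
    using gap[OF assms(1,2)] gap[OF assms(2,1)] assms(3) unfolding p_def by linarith
qed

section \<open>Vertices telling apart two vertices of the same part\<close>

text \<open>Here \<open>9/20\<close> is \<open>1/2 - 1/10 * 1/2\<close>, using that \<epsilon>' is
  below 1/2. Either value of \<sigma> will do, so later it is enough that one of $V_0$ and $V_1$ has
  few moved vertices.\<close>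

lemma codegree_V2:
  assumes "j \<in> {1..M}" "j' \<in> {1..M}" "j \<noteq> j'" "\<sigma> \<in> {0, 1}"
  shows "9/20 * real N \<le> real (card {u\<in>G_part l \<sigma>. ({u, (2, j)} \<in> E) \<noteq> ({u, (2, j')} \<in> E)})"
proof -
  have part: "G_part l \<sigma> = Pair \<sigma> ` {1..N}"
    using assms(4) by (auto simp: parts)
  have "{i\<in>{1..N}. ({(\<sigma>, i), (2, j)} \<in> E) \<noteq> ({(\<sigma>, i), (2, j')} \<in> E)} = {i\<in>{1..N}. B i j \<noteq> B i j'}"
    using edge_iff(3)[OF assms(4)] assms(1,2) by blast
  then show ?thesis
    using B_columns[OF assms(1-3)] eps'_N_le unfolding part card_filter_Pair by simp
qed

lemma codegree_V01:
  assumes "i \<in> {1..N}" "i' \<in> {1..N}" "i \<noteq> i'" "\<sigma> \<in> {0, 1}"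
  shows "9/20 * real M \<le> real (card {u\<in>G_part l 2. ({u, (\<sigma>, i)} \<in> E) \<noteq> ({u, (\<sigma>, i')} \<in> E)})"
proof -
  have "{j\<in>{1..M}. ({(2, j), (\<sigma>, i)} \<in> E) \<noteq> ({(2, j), (\<sigma>, i')} \<in> E)} = {j\<in>{1..M}. B i j \<noteq> B i' j}"
    using edge_iff(4)[OF assms(4)] assms(1,2) by blast
  moreover have "\<epsilon>' * real M \<le> real M / 2"
    using mult_right_mono[of \<epsilon>' "1/2" "real M"] eps' by simp
  ultimately show ?thesis
    using B_rows[OF assms(1-3)] unfolding parts card_filter_Pair by simp
qed

section \<open>Disagreement forced at a moved vertex by a fixed permutation\<close>

context
  fixes \<pi> :: "nat \<times> nat \<Rightarrow> nat \<times> nat"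
  assumes \<pi>: "\<pi> permutes V"
begin

abbreviation "dis \<equiv> disagreement V E \<pi>"
abbreviation "changes \<equiv> card (sym_diff E ((`) \<pi> ` E))"
abbreviation "moved \<sigma> \<equiv> {u\<in>G_part l \<sigma>. \<pi> u \<noteq> u}"
abbreviation "exiled \<sigma> \<equiv> {u\<in>G_part l \<sigma>. fst (\<pi> u) \<noteq> \<sigma>}"

lemma changes_ge:
  assumes "W \<subseteq> V" and "\<And>v. v \<in> W \<Longrightarrow> c \<le> real (dis v)"
  shows "real (card W) * c \<le> 2 * real changes"
proof -
  have "real (card W) * c \<le> (\<Sum>v\<in>W. real (dis v))"
    using sum_mono[of W "\<lambda>_. c" "\<lambda>v. real (dis v)"] assms(2) by simp
  also have "\<dots> \<le> (\<Sum>v\<in>V. real (dis v))"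
    by (intro sum_mono2 finite_G_verts assms(1)) simp
  also have "\<dots> \<le> 2 * real changes"
    using sum_disagreement_le[OF finite_G_verts G_edges_subset \<pi>, of nmE B]
    unfolding of_nat_sum[symmetric] by linarith
  finally show ?thesis .
qed

lemma perm_in_V: "v \<in> V \<Longrightarrow> \<pi> v \<in> V"
  by (rule permutes_in_image[OF \<pi>, THEN iffD2])

lemma dis_exiled:
  assumes "v \<in> V" "fst (\<pi> v) \<noteq> fst v"
  shows "1/10 * (\<epsilon>' * real N) \<le> real (dis v)"
  using degree_gap[OF assms(1) perm_in_V[OF assms(1)] assms(2)[symmetric]]
    degree_diff_le_disagreement[OF finite_G_verts G_edges_subset \<pi>]
  by (rule order_trans)

lemma dis_V2:
  assumes "\<sigma> \<in> {0, 1}" "real (card (moved \<sigma>)) \<le> 1/5 * real N" "v \<in> moved 2"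
  shows "1/10 * (\<epsilon>' * real N) \<le> real (dis v)"
proof (cases "fst (\<pi> v) = 2")
  case True
  obtain j where v: "v = (2, j)" "j \<in> {1..M}"
    using assms(3) by (auto simp: parts)
  have "\<pi> v \<in> V"
    using assms(3) by (intro perm_in_V) (auto simp: G_verts_def)
  then obtain j' where j': "\<pi> v = (2, j')" "j' \<in> {1..M}"
    using True by (cases rule: V_cases) auto
  have "G_part l \<sigma> \<subseteq> V"
    using assms(1) by (auto simp: G_verts_def)
  then have "card {u\<in>G_part l \<sigma>. ({u, v} \<in> E) \<noteq> ({u, \<pi> v} \<in> E)} \<le> dis v + card (moved \<sigma>)"
    by (rule card_distinguishing_le_disagreement[OF finite_G_verts])
  moreover have "j \<noteq> j'"
    using assms(3) v j' by auto
  ultimately have "9/20 * real N \<le> real (dis v) + real (card (moved \<sigma>))"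
    using codegree_V2[OF v(2) j'(2) _ assms(1)] unfolding v(1) j'(1)[unfolded v(1)] by linarith
  \<comment> \<open>At least \<open>9/20 - 1/5 = 1/4\<close> of \<open>N\<close> remains, whereas
    \<open>\<epsilon>' * N / 10\<close> is at most \<open>N / 20\<close>.\<close>
  then show ?thesis
    using assms(2) eps'_N_le by linarith
next
  case False
  have "v \<in> V" "fst v = 2"
    using assms(3) by (auto simp: G_verts_def G_part_def)
  with False show ?thesis
    by (intro dis_exiled) auto
qed

lemma dis_V01:
  assumes "\<sigma> \<in> {0, 1}" "real (card (moved 2)) \<le> 1/5 * real M" "v \<in> moved \<sigma>"
  shows "1/10 * (\<epsilon>' * real N) \<le> real (dis v)"
proof (cases "fst (\<pi> v) = \<sigma>")
  case True
  obtain i where v: "v = (\<sigma>, i)" "i \<in> {1..N}"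
    using assms(1,3) by (auto simp: parts)
  have "\<pi> v \<in> V"
    using assms(1,3) by (intro perm_in_V) (auto simp: G_verts_def)
  then obtain i' where i': "\<pi> v = (\<sigma>, i')" "i' \<in> {1..N}"
    using True assms(1) by (cases rule: V_cases) auto
  have "G_part l 2 \<subseteq> V"
    by (auto simp: G_verts_def)
  then have "card {u\<in>G_part l 2. ({u, v} \<in> E) \<noteq> ({u, \<pi> v} \<in> E)} \<le> dis v + card (moved 2)"
    by (rule card_distinguishing_le_disagreement[OF finite_G_verts])
  moreover have "i \<noteq> i'"
    using assms(3) v i' by auto
  ultimately have "9/20 * real M \<le> real (dis v) + real (card (moved 2))"
    using codegree_V01[OF v(2) i'(2) _ assms(1)] unfolding v(1) i'(1)[unfolded v(1)] by linarith
  then show ?thesis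
    using assms(2) eps'_N_le real_M by linarith
next
  case False
  have "v \<in> V" "fst v = \<sigma>"
    using assms(1,3) by (auto simp: G_verts_def G_part_def)
  with False show ?thesis
    by (intro dis_exiled) auto
qed

section \<open>Many changed edges from non-malleability or from vertices leaving their part\<close>

text \<open>The first argument of \<open>nmE\<close> indexes $V_1$ and the second $V_0$, so the
  actions of \<pi> on the two index sets are independent tampering functions, free of fixed points
  on \<open>A\<close> and \<open>C\<close>.\<close>

lemma changes_ge_extractor:
  assumes "A \<subseteq> {i\<in>{1..N}. fst (\<pi> (1, i)) = 1 \<and> \<pi> (1, i) \<noteq> (1, i)}" "1/10 * real N \<le> real (card A)"
    and "C \<subseteq> {j\<in>{1..N}. fst (\<pi> (0, j)) = 0 \<and> \<pi> (0, j) \<noteq> (0, j)}" "1/10 * real N \<le> real (card C)"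
  shows "(1/2 - \<epsilon>) * real (card A) * real (card C) \<le> 2 * real changes"
proof -
  define f where "f i = snd (\<pi> (1, i))" for i
  define g where "g j = snd (\<pi> (0, j))" for j
  have f: "\<pi> (1, i) = (1, f i)" "f i \<in> {1..N}" "f i \<noteq> i" if "i \<in> A" for i
  proof -
    have i: "i \<in> {1..N}" "fst (\<pi> (1, i)) = 1" "\<pi> (1, i) \<noteq> (1, i)"
      using that assms(1) by blast+
    then show \<pi>i: "\<pi> (1, i) = (1, f i)"
      unfolding f_def by (metis prod.collapse)
    have "\<pi> (1, i) \<in> V"
      using i(1) by (intro perm_in_V) (auto simp: G_verts_def parts)
    then show "f i \<in> {1..N}" "f i \<noteq> i"
      using i(3) unfolding \<pi>i G_verts_def parts by auto
  qed
  have g: "\<pi> (0, j) = (0, g j)" "g j \<in> {1..N}" "g j \<noteq> j" if "j \<in> C" for j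
  proof -
    have j: "j \<in> {1..N}" "fst (\<pi> (0, j)) = 0" "\<pi> (0, j) \<noteq> (0, j)"
      using that assms(3) by blast+
    then show \<pi>j: "\<pi> (0, j) = (0, g j)"
      unfolding g_def by (metis prod.collapse)
    have "\<pi> (0, j) \<in> V"
      using j(1) by (intro perm_in_V) (auto simp: G_verts_def parts)
    then show "g j \<in> {1..N}" "g j \<noteq> j"
      using j(3) unfolding \<pi>j G_verts_def parts by auto
  qed
  have sub: "A \<subseteq> {1..N}" "C \<subseteq> {1..N}"
    using assms(1,3) by blast+
  \<comment> \<open>The threshold \<open>N / 10\<close> on the sizes of \<open>A\<close> and
    \<open>C\<close> exceeds \<open>2 ^ l / 16\<close>, so the uniform distributions on them are
    \<open>k\<close>-sources.\<close>
  have "2 powr k \<le> 2 powr (real l - 4)"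
    using k by simp
  also have "\<dots> = (real N + 1) / 16"
    using two_power_l by (simp add: powr_diff powr_realpow)
  finally have k': "2 powr k \<le> 1/10 * real N"
    using N_ge by simp
  define D where "D x = {y\<in>C. nmE x y \<noteq> nmE (f x) (g y)}" for x
  have fin: "finite A" "finite C"
    using sub finite_subset by blast+
  have "(1/2 - \<epsilon>) * real (card A) * real (card C)
      \<le> real (card {(x, y) \<in> A \<times> C. nmE x y \<noteq> nmE (f x) (g y)})"
    using nm_two_source_extractor_changes[OF extractor sub(1) _ sub(2), of f g] f g assms(2,4) k' N_ge
    by auto
  also have "{(x, y) \<in> A \<times> C. nmE x y \<noteq> nmE (f x) (g y)} = (SIGMA x:A. D x)"
    by (auto simp: D_def)
  also have "card \<dots> = (\<Sum>x\<in>A. card (D x))"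
    using fin by (subst card_SigmaI) (auto simp: D_def)
  \<comment> \<open>The changed pairs are grouped by their endpoint in $V_1$; each \<open>y\<close>
    in \<open>D x\<close> makes \<open>(0, y)\<close> disagree with \<open>(1, x)\<close>.\<close>
  also have "\<dots> \<le> (\<Sum>x\<in>A. dis (1, x))"
  proof (rule sum_mono)
    fix x assume x: "x \<in> A"
    have "Pair (0::nat) ` D x \<subseteq> {u\<in>V. ({u, (1, x)} \<in> E) \<noteq> ({\<pi> u, \<pi> (1, x)} \<in> E)}"
    proof
      fix u assume "u \<in> Pair (0::nat) ` D x"
      then obtain y where y: "u = (0, y)" "y \<in> C" "nmE x y \<noteq> nmE (f x) (g y)"
        by (auto simp: D_def)
      moreover have "{(0, y), (1, x)} \<in> E \<longleftrightarrow> nmE x y"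
        by (rule edge_iff(2)) (use x y(2) sub in blast)+
      moreover have "{(0, g y), (1, f x)} \<in> E \<longleftrightarrow> nmE (f x) (g y)"
        by (rule edge_iff(2)) (use f(2)[OF x] g(2)[OF y(2)] in blast)+
      moreover have "u \<in> V"
        using y(1,2) sub(2) by (auto simp: G_verts_def parts)
      ultimately show "u \<in> {u\<in>V. ({u, (1, x)} \<in> E) \<noteq> ({\<pi> u, \<pi> (1, x)} \<in> E)}"
        using f(1)[OF x] g(1)[OF y(2)] by simp
    qed
    then have "card (Pair (0::nat) ` D x) \<le> dis (1, x)"
      unfolding disagreement_def by (rule card_mono[rotated]) (simp add: finite_G_verts)
    then show "card (D x) \<le> dis (1, x)"
      by (simp add: card_image inj_on_def)
  qed
  also have "(\<Sum>x\<in>A. dis (1, x)) = (\<Sum>v\<in>Pair 1 ` A. dis v)"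
    by (simp add: sum.reindex inj_on_def)
  also have "\<dots> \<le> (\<Sum>v\<in>V. dis v)"
    using sub by (intro sum_mono2 finite_G_verts) (auto simp: G_verts_def parts)
  also have "\<dots> \<le> 2 * changes"
    by (rule sum_disagreement_le[OF finite_G_verts G_edges_subset \<pi>])
  finally show ?thesis
    by simp
qed

lemma card_moved_split:
  assumes "\<sigma> \<in> {0, 1}"
  shows "card (moved \<sigma>) \<le> card (exiled \<sigma>)
     + card {i\<in>{1..N}. fst (\<pi> (\<sigma>, i)) = \<sigma> \<and> \<pi> (\<sigma>, i) \<noteq> (\<sigma>, i)}"
proof -
  have part: "G_part l \<sigma> = Pair \<sigma> ` {1..N}"
    using assms by (auto simp: parts)
  have "card (moved \<sigma>) \<le> card (exiled \<sigma> \<union> {u\<in>G_part l \<sigma>. fst (\<pi> u) = \<sigma> \<and> \<pi> u \<noteq> u})"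
    using finite_part by (intro card_mono) auto
  also have "\<dots> \<le> card (exiled \<sigma>) + card {u\<in>G_part l \<sigma>. fst (\<pi> u) = \<sigma> \<and> \<pi> u \<noteq> u}"
    by (rule card_Un_le)
  also have "{u\<in>G_part l \<sigma>. fst (\<pi> u) = \<sigma> \<and> \<pi> u \<noteq> u} = {u\<in>Pair \<sigma> ` {1..N}. fst (\<pi> u) = \<sigma> \<and> \<pi> u \<noteq> u}"
    unfolding part ..
  finally show ?thesis
    by (simp only: card_filter_Pair)
qed

lemma changes_ge_of_many_exiled:
  assumes "\<sigma> \<in> {0, 1}" "1/10 * real N \<le> real (card (exiled \<sigma>))"
  shows "\<epsilon>' * (real N)\<^sup>2 \<le> 200 * real changes"
proof -
  have "exiled \<sigma> \<subseteq> V"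
    using assms(1) by (auto simp: G_verts_def)
  moreover have "1/10 * (\<epsilon>' * real N) \<le> real (dis v)" if "v \<in> exiled \<sigma>" for v
    using that assms(1) by (intro dis_exiled) (auto simp: G_verts_def G_part_def)
  ultimately have "real (card (exiled \<sigma>)) * (1/10 * (\<epsilon>' * real N)) \<le> 2 * real changes"
    by (rule changes_ge)
  moreover have "1/10 * real N * (1/10 * (\<epsilon>' * real N)) \<le> real (card (exiled \<sigma>)) * (1/10 * (\<epsilon>' * real N))"
    using assms(2) eps' by (intro mult_right_mono) auto
  ultimately show ?thesis
    by (simp add: power2_eq_square)
qed

section \<open>Case analysis and the final constant\<close>

text \<open>The first alternative is the bound per moved vertex. The other two are quadratic in
  \<open>N\<close>, which suffices because at most \<open>|V|\<close> vertices can be moved.\<close>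

lemma changes_lower_bound:
  "\<epsilon>' * real N * real (card {v\<in>V. \<pi> v \<noteq> v}) \<le> 20 * real changes \<or>
   \<epsilon>' * (real N)\<^sup>2 \<le> 200 * real changes \<or>
   (1/2 - \<epsilon>) * (real N)\<^sup>2 \<le> 200 * real changes"
proof (cases "\<exists>\<sigma>\<in>{0, 1}. real (card (moved \<sigma>)) \<le> 1/5 * real N")
  case True
  then obtain \<sigma> where \<sigma>: "\<sigma> \<in> {0, 1}" "real (card (moved \<sigma>)) \<le> 1/5 * real N"
    by blast
  show ?thesis
  proof (cases "real (card (moved 2)) \<le> 1/5 * real M")
    case True
    \<comment> \<open>Few moved vertices in $V_2$ and in one of $V_0$, $V_1$: every moved vertex, in
      whichever part, has large disagreement.\<close>
    have "1/10 * (\<epsilon>' * real N) \<le> real (dis v)" if "v \<in> {v\<in>V. \<pi> v \<noteq> v}" for v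
      using that dis_V2[OF \<sigma>, of v] dis_V01[OF _ True, of _ v] unfolding G_verts_def by blast
    then have "real (card {v\<in>V. \<pi> v \<noteq> v}) * (1/10 * (\<epsilon>' * real N)) \<le> 2 * real changes"
      by (intro changes_ge) auto
    then show ?thesis
      by (simp add: mult_ac)
  next
    case False
    \<comment> \<open>More than \<open>M / 5\<close> vertices of $V_2$ are moved, and each of these
      has large disagreement; $V_0$ and $V_1$ can be ignored.\<close>
    have "real (card (moved 2)) * (1/10 * (\<epsilon>' * real N)) \<le> 2 * real changes"
      using dis_V2[OF \<sigma>] by (intro changes_ge) (auto simp: G_verts_def)
    moreover have "1/10 * real N * (1/10 * (\<epsilon>' * real N)) \<le> real (card (moved 2)) * (1/10 * (\<epsilon>' * real N))"
      using False eps' real_M by (intro mult_right_mono) auto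
    ultimately show ?thesis
      by (simp add: power2_eq_square)
  qed
next
  case False
  show ?thesis
  proof (cases "\<exists>\<sigma>\<in>{0, 1}. 1/10 * real N \<le> real (card (exiled \<sigma>))")
    case True
    then show ?thesis
      using changes_ge_of_many_exiled by blast
  next
    case exiled: False
    define S where "S \<sigma> = {i\<in>{1..N}. fst (\<pi> (\<sigma>, i)) = \<sigma> \<and> \<pi> (\<sigma>, i) \<noteq> (\<sigma>, i)}" for \<sigma>
    have S: "1/10 * real N \<le> real (card (S \<sigma>))" if "\<sigma> \<in> {0, 1}" for \<sigma>
    proof -
      \<comment> \<open>More than \<open>N / 5\<close> vertices are moved and fewer than
        \<open>N / 10\<close> leave the part, so more than \<open>N / 10\<close> are moved inside
        it.\<close>
      have "\<not> real (card (moved \<sigma>)) \<le> 1/5 * real N" "\<not> 1/10 * real N \<le> real (card (exiled \<sigma>))"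
        using that False exiled by blast+
      then show ?thesis
        using card_moved_split[OF that] unfolding S_def by linarith
    qed
    have "(1/2 - \<epsilon>) * (1/10 * real N) * (1/10 * real N) \<le> (1/2 - \<epsilon>) * real (card (S 1)) * real (card (S 0))"
      using S eps by (intro mult_mono) auto
    also have "\<dots> \<le> 2 * real changes"
      using S by (intro changes_ge_extractor) (auto simp: S_def)
    finally show ?thesis
      by (simp add: power2_eq_square)
  qed
qed

lemma robustness:
  "\<epsilon>' * (1/2 - \<epsilon>) / 10000 * real (card V) * real (card {v\<in>V. \<pi> v \<noteq> v}) \<le> real changes"
proof -
  define c t where "c = \<epsilon>' * (1/2 - \<epsilon>) / 10000" and "t = real (card {v\<in>V. \<pi> v \<noteq> v})"
  \<comment> \<open>Both factors \<epsilon>' and \<open>1/2 - \<epsilon>\<close> are at most 1/2, so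
    the product over 10000 is at most either factor over 20000. With \<open>|V| \<le> 7 * N\<close>
    the quadratic cases need \<open>49 * 200 * c\<close>, which is at most \<open>20000 * c\<close>;
    the linear case needs only \<open>140 * c\<close>.\<close>
  have c: "0 \<le> c" "20000 * c \<le> \<epsilon>'" "20000 * c \<le> 1/2 - \<epsilon>"
    using eps eps' mult_left_mono[of "1/2 - \<epsilon>" "1/2" \<epsilon>'] mult_right_mono[of \<epsilon>' "1/2" "1/2 - \<epsilon>"]
    by (auto simp: c_def)
  have V: "real (card V) \<le> 7 * real N"
    using N_ge by (simp add: card_V)
  have "card {v\<in>V. \<pi> v \<noteq> v} \<le> card V"
    using finite_G_verts by (intro card_mono) auto
  then have t: "t \<le> 7 * real N" "0 \<le> t"
    using V by (auto simp: t_def)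
  have "c * (7 * real N) * t \<le> c * (7 * real N) * (7 * real N)"
    using c t by (intro mult_left_mono) auto
  then have square: "c * (7 * real N) * t \<le> 49 * c * (real N)\<^sup>2" "0 \<le> c * (real N)\<^sup>2"
    using c by (simp_all add: power2_eq_square)
  have "c * real (card V) * t \<le> c * (7 * real N) * t"
    using c V t by (intro mult_right_mono mult_left_mono) auto
  also have "\<dots> \<le> real changes"
    using changes_lower_bound
  proof (elim disjE)
    assume "\<epsilon>' * real N * real (card {v\<in>V. \<pi> v \<noteq> v}) \<le> 20 * real changes"
    moreover have "20000 * c * (real N * t) \<le> \<epsilon>' * (real N * t)"
      using c t by (intro mult_right_mono) auto
    ultimately show ?thesis
      by (simp add: t_def mult_ac)
  next
    assume "\<epsilon>' * (real N)\<^sup>2 \<le> 200 * real changes"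
    moreover have "20000 * c * (real N)\<^sup>2 \<le> \<epsilon>' * (real N)\<^sup>2"
      using c by (intro mult_right_mono) auto
    ultimately show ?thesis
      using square by linarith
  next
    assume "(1/2 - \<epsilon>) * (real N)\<^sup>2 \<le> 200 * real changes"
    moreover have "20000 * c * (real N)\<^sup>2 \<le> (1/2 - \<epsilon>) * (real N)\<^sup>2"
      using c by (intro mult_right_mono) auto
    ultimately show ?thesis
      using square by linarith
  qed
  finally show ?thesis
    by (simp add: c_def t_def)
qed

end

end

theorem theorem8p7:
  fixes \<epsilon> \<epsilon>' :: real
  assumes "\<epsilon> \<in> {0<..<0.5}" and "\<epsilon>' \<in> {0<..<0.5}"
  shows "\<exists>c::real. c > 0 \<and>
    (\<forall>(l::nat) (k::real) (nmE :: nat \<Rightarrow> nat \<Rightarrow> bool) (B :: nat \<Rightarrow> nat \<Rightarrow> bool).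
       0 \<le> k \<and> k \<le> real l - 4 \<and>
       nm_two_source_extractor (2 ^ l - 1) k \<epsilon> nmE \<and>
       (\<forall>x\<in>{1..2 ^ l - 1}. real (card {y\<in>{1..2 ^ l - 1}. nmE x y}) > \<epsilon>' * 2 ^ l) \<and>
       quasi_orthogonal {1..2 ^ l - 1} {1..2 ^ (l + 2) - 1} B (0.1 * \<epsilon>')
       \<longrightarrow>
       robustly_self_ordered (c * real (card (G_verts l))) (G_verts l) (G_edges l nmE B) \<and>
       (\<forall>v\<in>G_verts l.
          0.3 * real (card (G_verts l)) \<le> real (degree_in (G_edges l nmE B) v) \<and>
          real (degree_in (G_edges l nmE B) v) \<le> 0.9 * real (card (G_verts l))))"
proof (intro exI conjI allI impI)
  \<comment> \<open>The witness is fixed before \<open>l\<close>, \<open>k\<close>,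
    \<open>nmE\<close> and \<open>B\<close>, and is positive because \<epsilon> is below
    1/2.\<close>
  show "0 < \<epsilon>' * (1/2 - \<epsilon>) / 10000"
    using assms by simp
next
  fix l :: nat and k :: real and nmE B :: "nat \<Rightarrow> nat \<Rightarrow> bool"
  assume "0 \<le> k \<and> k \<le> real l - 4 \<and>
       nm_two_source_extractor (2 ^ l - 1) k \<epsilon> nmE \<and>
       (\<forall>x\<in>{1..2 ^ l - 1}. real (card {y\<in>{1..2 ^ l - 1}. nmE x y}) > \<epsilon>' * 2 ^ l) \<and>
       quasi_orthogonal {1..2 ^ l - 1} {1..2 ^ (l + 2) - 1} B (0.1 * \<epsilon>')"
  then interpret nm_graph \<epsilon> \<epsilon>' k l "2 ^ l - 1" "2 ^ (l + 2) - 1" nmE B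
    using assms by unfold_locales auto
  show "robustly_self_ordered (\<epsilon>' * (1/2 - \<epsilon>) / 10000 * real (card V)) V E"
    unfolding robustly_self_ordered_def using robustness by blast
  show "\<forall>v\<in>V. 0.3 * real (card V) \<le> real (degree_in E v) \<and> real (degree_in E v) \<le> 0.9 * real (card V)"
    using degree_bounds by blast
qed

end
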